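(* Let $K$ be a field, $S=K[x_1,\ldots,x_n]$, and let $I\subset S$ be a monomial complete intersection, minimally generated by $3$ monomials of degrees $d_1$, $d_2$ and $d_3$. Then $$\operatorname{slength}(I)\leq d_1+d_2+d_3+1.$$
   Context: Let $M$ be a finitely generated $\mathbb Z^n$-graded $S$-module, $S=K[x_1,\ldots,x_n]$. A Stanley decomposition of $M$ is a finite direct sum of $K$-vector spaces $\mathcal D: M=\bigoplus_{i=1}^r m_iK[Z_i]$, where each $m_i\in M$ is homogeneous, $Z_i\subset\{x_1,\ldots,x_n\}$, and $m_iK[Z_i]$ is a free $K[Z_i]$-module. Its length is $\operatorname{slength}(\mathcal D)=r$, and the Stanley length of $M$ is $\operatorname{slength}(M)=\min\{\operatorname{slength}(\mathcal D):\mathcal D\text{ is a Stanley decomposition of }M\}$. A monomial ideal is a complete intersection if its minimal monomial generators form a regular sequence, equivalently they are pairwise coprime nonunit monomials. *)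

theory Defs
  imports Main "HOL-Library.Poly_Mapping" "HOL-Library.Extended_Nat"
begin

text \<open>
  The polynomial ring \<open>K[x\<^sub>1,\<dots>,x\<^sub>n]\<close> is the monoid algebra of exponent vectors; the variables
  are the elements of a finite type \<open>'x\<close> and \<open>n = CARD('x)\<close>.
\<close>

type_synonym 'x expo = "'x \<Rightarrow>\<^sub>0 nat"

type_synonym ('x, 'k) mpoly = "('x \<Rightarrow>\<^sub>0 nat) \<Rightarrow>\<^sub>0 'k"

definition monom :: "'x expo \<Rightarrow> ('x, 'k::field) mpoly"
  where "monom u = Poly_Mapping.single u 1"

definition mdeg :: "'x::finite expo \<Rightarrow> nat"
  where "mdeg u = (\<Sum>x\<in>UNIV. Poly_Mapping.lookup u x)"

definition poly_subring :: "'x set \<Rightarrow> ('x, 'k::field) mpoly set"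
  where "poly_subring Z = {f. \<forall>t\<in>Poly_Mapping.keys f. Poly_Mapping.keys t \<subseteq> Z}"

text \<open>The component of multidegree \<open>a\<close>; it is \<open>{0}\<close> if \<open>a\<close> has a negative entry.\<close>

definition mpoly_component :: "('x \<Rightarrow> int) \<Rightarrow> ('x, 'k::field) mpoly set"
  where "mpoly_component a = {f. \<forall>t\<in>Poly_Mapping.keys f. (\<lambda>x. int (Poly_Mapping.lookup t x)) = a}"


section \<open>Stanley decompositions\<close>

definition direct_sum_decomp :: "'m::ab_group_add set \<Rightarrow> nat \<Rightarrow> (nat \<Rightarrow> 'm set) \<Rightarrow> bool"
  where "direct_sum_decomp M r V \<longleftrightarrow>
    M = {\<Sum>i<r. v i | v. \<forall>i<r. v i \<in> V i} \<and>
    (\<forall>v. (\<forall>i<r. v i \<in> V i) \<and> (\<Sum>i<r. v i) = 0 \<longrightarrow> (\<forall>i<r. v i = 0))"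

definition stanley_space ::
    "(('x, 'k::field) mpoly \<Rightarrow> 'm \<Rightarrow> 'm) \<Rightarrow> 'm \<Rightarrow> 'x set \<Rightarrow> 'm set"
  where "stanley_space scale m Z = (\<lambda>f. scale f m) ` poly_subring Z"

text \<open>
  The graded module is the submodule \<open>M\<close> of the ambient \<open>S\<close>-module with scalar multiplication
  \<open>scale\<close>; its component of multidegree \<open>a\<close> is \<open>M \<inter> gr a\<close>. A decomposition
  is the list of its pairs \<open>(m\<^sub>i, Z\<^sub>i)\<close>. The third condition says that the cyclic
  module \<open>m\<^sub>iK[Z\<^sub>i]\<close> is free with basis \<open>m\<^sub>i\<close>.
\<close>

definition stanley_decomposition ::
    "(('x::finite, 'k::field) mpoly \<Rightarrow> 'm::ab_group_add \<Rightarrow> 'm) \<Rightarrow> (('x \<Rightarrow> int) \<Rightarrow> 'm set) \<Rightarrow>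
      'm set \<Rightarrow> ('m \<times> 'x set) list \<Rightarrow> bool"
  where "stanley_decomposition scale gr M D \<longleftrightarrow>
    (\<forall>(m, Z) \<in> set D. m \<in> M \<and> (\<exists>a. m \<in> gr a) \<and>
       (\<forall>f\<in>poly_subring Z. scale f m = 0 \<longrightarrow> f = 0)) \<and>
    direct_sum_decomp M (length D) (\<lambda>i. stanley_space scale (fst (D ! i)) (snd (D ! i)))"

text \<open>
  The minimum is taken in \<^typ>\<open>enat\<close>, so that an upper bound by a natural number entails
  the existence of a decomposition.
\<close>

definition slength ::
    "(('x::finite, 'k::field) mpoly \<Rightarrow> 'm::ab_group_add \<Rightarrow> 'm) \<Rightarrow> (('x \<Rightarrow> int) \<Rightarrow> 'm set) \<Rightarrow>
      'm set \<Rightarrow> enat"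
  where "slength scale gr M = (INF D \<in> {D. stanley_decomposition scale gr M D}. enat (length D))"

definition ideal_slength :: "('x::finite, 'k::field) mpoly set \<Rightarrow> enat"
  where "ideal_slength I = slength (*) mpoly_component I"


section \<open>Monomial complete intersections\<close>

lemma module_times: "module ((*) :: 'a::comm_ring_1 \<Rightarrow> 'a \<Rightarrow> 'a)"
  by unfold_locales (simp_all add: algebra_simps)

abbreviation ideal_span :: "'a::comm_ring_1 set \<Rightarrow> 'a set"
  where "ideal_span \<equiv> module.span (*)"

definition regular_sequence :: "'a::comm_ring_1 list \<Rightarrow> bool"
  where "regular_sequence fs \<longleftrightarrow>
    (\<forall>i<length fs. \<forall>g. g * fs ! i \<in> ideal_span (set (take i fs)) \<longrightarrow>
       g \<in> ideal_span (set (take i fs))) \<and>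
    ideal_span (set fs) \<noteq> UNIV"

definition minimal_monomial_generators :: "('x, 'k::field) mpoly set \<Rightarrow> 'x expo set \<Rightarrow> bool"
  where "minimal_monomial_generators I U \<longleftrightarrow>
    I = ideal_span (monom ` U) \<and> (\<forall>V. V \<subset> U \<longrightarrow> I \<noteq> ideal_span (monom ` V))"

definition monomial_complete_intersection :: "('x, 'k::field) mpoly set \<Rightarrow> bool"
  where "monomial_complete_intersection I \<longleftrightarrow>
    (\<exists>us. distinct us \<and> minimal_monomial_generators I (set us) \<and> 
       regular_sequence (map monom us :: ('x, 'k) mpoly list))"

end

theory Submission
  imports Defs "HOL-Library.Disjoint_Sets"
begin

text \<open>
  A monomial ideal is spanned over \<open>K\<close> by its monomials, so partitioning their exponents into
  cones \<open>a + \<nat>\<^sup>Z\<close> gives a Stanley decomposition. The generators \<open>u\<^sub>1\<close>, \<open>u\<^sub>2\<close>, \<open>u\<^sub>3\<close> are pairwise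
  coprime. Sort the monomials of the ideal by which generators divide them: up to the monomials
  divisible by all three, which form the single cone \<open>u\<^sub>1u\<^sub>2u\<^sub>3K[x\<^sub>1,\<dots>,x\<^sub>n]\<close>, each of them satisfies
  exactly one of the cyclic conditions ``\<open>u\<^sub>1\<close> but not \<open>u\<^sub>3\<close>'', ``\<open>u\<^sub>2\<close> but not \<open>u\<^sub>1\<close>'' and
  ``\<open>u\<^sub>3\<close> but not \<open>u\<^sub>2\<close>''. The monomials not divisible by \<open>u\<close> split into \<open>deg u\<close> cones, and by
  coprimality a translation by \<open>u\<^sub>1\<close> maps those not divisible by \<open>u\<^sub>3\<close> onto the first class, and
  likewise for the other two.
\<close>

abbreviation (input) "lookup \<equiv> Poly_Mapping.lookup"
abbreviation (input) "keys \<equiv> Poly_Mapping.keys"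

section \<open>Multiples of a monomial\<close>

definition multiples :: "'x expo \<Rightarrow> 'x expo set"
  where "multiples u = range ((+) u)"

lemma mem_multiples: "t \<in> multiples u \<longleftrightarrow> (\<forall>x. lookup u x \<le> lookup t x)"
proof
  assume "\<forall>x. lookup u x \<le> lookup t x"
  \<comment> \<open>Subtraction of exponents is truncated; the coordinatewise bound makes it exact
    here.\<close>
  then have "t = u + (t - u)"
    by (intro poly_mapping_eqI) (simp add: lookup_add lookup_minus)
  then show "t \<in> multiples u" unfolding multiples_def by blast
qed (auto simp: multiples_def lookup_add)

lemma multiples_refl: "u \<in> multiples u"
  by (simp add: mem_multiples)

lemma multiples_trans: "s \<in> multiples t \<Longrightarrow> t \<in> multiples u \<Longrightarrow> s \<in> multiples u"
  by (meson mem_multiples order_trans)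

lemma multiples_antisym: "s \<in> multiples t \<Longrightarrow> t \<in> multiples s \<Longrightarrow> s = t"
  by (intro poly_mapping_eqI) (simp add: mem_multiples order_antisym)

lemma diff_add_multiples: "t \<in> multiples u \<Longrightarrow> t - u + u = t"
  by (auto simp: multiples_def add.commute)

section \<open>Terms of a polynomial and multiplication by a monomial\<close>

lemma sum_single_lookup:
  "(\<Sum>t\<in>keys f. Poly_Mapping.single t (lookup f t)) = f"
  by (rule poly_mapping_eqI) (simp add: lookup_sum lookup_single when_def sum.delta' in_keys_iff)

lemma times_monom: "f * monom t = (\<Sum>s\<in>keys f. Poly_Mapping.single (s + t) (lookup f s))"
proof -
  have "f * monom t = (\<Sum>s\<in>keys f. Poly_Mapping.single s (lookup f s)) * monom t"
    by (simp add: sum_single_lookup)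
  then show ?thesis
    by (simp add: sum_distrib_right monom_def mult_single)
qed

text \<open>Translation by \<open>t\<close> is injective on exponents, so no two terms merge. This
  later gives freeness of the cyclic modules.\<close>

lemma lookup_times_monom: "lookup (f * monom t) (s + t) = lookup f s"
proof -
  have "lookup (f * monom t) (s + t) = (\<Sum>r\<in>keys f. lookup f r when r = s)"
    by (simp add: times_monom lookup_sum lookup_single)
  also have "\<dots> = lookup f s"
    by (simp add: when_def sum.delta in_keys_iff)
  finally show ?thesis .
qed

lemma keys_times_monom: "keys (f * monom t) \<subseteq> (\<lambda>s. s + t) ` keys f"
  using keys_mult[of f "monom t"] by (force simp: monom_def)

section \<open>Monomial ideals\<close>

interpretation mult_module: module "(*) :: 'a::comm_ring_1 \<Rightarrow> 'a \<Rightarrow> 'a"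
  by (rule module_times)

text \<open>The right-hand side is an ideal containing the generators, and every single term of a
  member is already a multiple of a generator. Questions about the ideal thus become questions about
  sets of exponents.\<close>

lemma ideal_span_monom:
  "ideal_span (monom ` U) = {f :: ('x, 'k::field) mpoly. keys f \<subseteq> (\<Union>u\<in>U. multiples u)}"
    (is "_ = ?J")
proof
  have "mult_module.subspace ?J"
  proof (rule mult_module.subspaceI)
    fix c f :: "('x, 'k) mpoly"
    assume f: "f \<in> ?J"
    show "c * f \<in> ?J"
    proof safe
      fix t assume "t \<in> keys (c * f)"
      then obtain a b where t: "t = a + b" and "b \<in> keys f" using keys_mult[of c f] by blast
      then obtain u where "u \<in> U" "b \<in> multiples u" using f by blast
      then show "t \<in> (\<Union>u\<in>U. multiples u)"
        by (auto simp: t mem_multiples lookup_add intro: trans_le_add2)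
    qed
  next
    fix f g :: "('x, 'k) mpoly"
    assume "f \<in> ?J" "g \<in> ?J"
    then show "f + g \<in> ?J" using keys_add[of f g] by blast
  qed simp
  moreover have "monom ` U \<subseteq> ?J"
    by (auto simp: monom_def intro: multiples_refl)
  ultimately show "ideal_span (monom ` U) \<subseteq> ?J"
    by (intro mult_module.span_minimal)
next
  show "?J \<subseteq> ideal_span (monom ` U)"
  proof
    fix f :: "('x, 'k) mpoly"
    assume f: "f \<in> ?J"
    have "(\<Sum>t\<in>keys f. Poly_Mapping.single t (lookup f t)) \<in> ideal_span (monom ` U)"
    proof (rule mult_module.span_sum)
      fix t assume "t \<in> keys f"
      then obtain u where u: "u \<in> U" "t \<in> multiples u" using f by blast
      have "Poly_Mapping.single t (lookup f t) =
          Poly_Mapping.single (t - u) (lookup f t) * monom u"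
        by (simp add: monom_def mult_single diff_add_multiples[OF u(2)])
      also have "\<dots> \<in> ideal_span (monom ` U)"
        using u by (intro mult_module.span_scale mult_module.span_base) auto
      finally show "Poly_Mapping.single t (lookup f t) \<in> ideal_span (monom ` U)" .
    qed
    then show "f \<in> ideal_span (monom ` U)" by (simp add: sum_single_lookup)
  qed
qed

lemma monom_in_ideal_span:
  "(monom t :: ('x, 'k::field) mpoly) \<in> ideal_span (monom ` U) \<longleftrightarrow> (\<exists>u\<in>U. t \<in> multiples u)"
  unfolding ideal_span_monom by (simp add: monom_def)

section \<open>Uniqueness of the minimal monomial generators\<close>

lemma minimal_monomial_generators_antichain:
  fixes I :: "('x, 'k::field) mpoly set"
  assumes I: "minimal_monomial_generators I U" and u: "u \<in> U" "v \<in> U" "u \<in> multiples v"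
  shows "u = v"
proof (rule ccontr)
  assume "u \<noteq> v"
  \<comment> \<open>A generator divisible by another one could be dropped, against
    minimality.\<close>
  have "(\<Union>w\<in>U. multiples w) = (\<Union>w\<in>U - {u}. multiples w)"
    using u \<open>u \<noteq> v\<close> by (auto intro: multiples_trans)
  then have "I = ideal_span (monom ` (U - {u}))"
    using I unfolding minimal_monomial_generators_def ideal_span_monom by simp
  moreover have "U - {u} \<subset> U" using u by blast
  ultimately show False using I unfolding minimal_monomial_generators_def by blast
qed

text \<open>Some \<open>v\<close> in \<open>V\<close> divides \<open>u\<close>, and some
  \<open>w\<close> in \<open>U\<close> divides \<open>v\<close>. The antichain property gives
  \<open>w = u\<close>, so \<open>u\<close> and \<open>v\<close> divide each other.\<close>

lemma minimal_monomial_generators_subset: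
  fixes I :: "('x, 'k::field) mpoly set"
  assumes U: "minimal_monomial_generators I U" and V: "minimal_monomial_generators I V"
  shows "U \<subseteq> V"
proof
  fix u assume u: "u \<in> U"
  have span: "I = ideal_span (monom ` U)" "I = ideal_span (monom ` V)"
    using U V by (simp_all add: minimal_monomial_generators_def)
  have "(monom u :: ('x, 'k) mpoly) \<in> I"
    unfolding span(1) monom_in_ideal_span using u multiples_refl by blast
  then obtain v where v: "v \<in> V" "u \<in> multiples v"
    unfolding span(2) monom_in_ideal_span by blast
  have "(monom v :: ('x, 'k) mpoly) \<in> I"
    unfolding span(2) monom_in_ideal_span using v multiples_refl by blast
  then obtain w where w: "w \<in> U" "v \<in> multiples w"
    unfolding span(1) monom_in_ideal_span by blast
  have "u = w"
    by (rule minimal_monomial_generators_antichain[OF U u w(1) multiples_trans[OF v(2) w(2)]])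
  then have "u = v" using v w multiples_antisym by blast
  then show "u \<in> V" using v by simp
qed

text \<open>Identifies the generators listed in the regular sequence with any given minimal
  set.\<close>

lemma minimal_monomial_generators_unique:
  fixes I :: "('x, 'k::field) mpoly set"
  assumes "minimal_monomial_generators I U" "minimal_monomial_generators I V"
  shows "U = V"
  using assms minimal_monomial_generators_subset by blast

definition coprime_expo :: "'x expo \<Rightarrow> 'x expo \<Rightarrow> bool"
  where "coprime_expo u v \<longleftrightarrow> (\<forall>x. lookup u x = 0 \<or> lookup v x = 0)"

lemma coprime_expo_commute: "coprime_expo u v \<longleftrightarrow> coprime_expo v u"
  by (metis coprime_expo_def)

text \<open>The product of \<open>u / gcd(u, v)\<close> and \<open>v\<close> is
  \<open>lcm(u, v)\<close>, which lies in the ideal of the generators before \<open>v\<close>.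
  Regularity puts \<open>u / gcd(u, v)\<close> there too, and minimality then forces the gcd to be
  1.\<close>

lemma regular_sequence_coprime_expo:
  fixes I :: "('x, 'k::field) mpoly set"
  assumes us: "distinct us" and I: "minimal_monomial_generators I (set us)"
    and reg: "regular_sequence (map monom us :: ('x, 'k) mpoly list)"
    and ij: "i < j" "j < length us"
  shows "coprime_expo (us ! i) (us ! j)"
proof -
  define u v where uv: "u = us ! i" "v = us ! j"
  \<comment> \<open>As \<open>u - v\<close> is truncated, it is the exponent of \<open>u / gcd(u, v)\<close>.\<close>
  define g where "g = u - v"
  have set_take: "set (take j (map monom us :: ('x, 'k) mpoly list)) = monom ` set (take j us)"
    by (simp add: take_map)
  have u: "u \<in> set (take j us)"
    using ij by (auto simp: uv in_set_conv_nth intro!: exI[of _ i])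
  have "g + v \<in> multiples u"
    by (auto simp: mem_multiples g_def lookup_add lookup_minus)
  then have "(monom (g + v) :: ('x, 'k) mpoly) \<in> ideal_span (monom ` set (take j us))"
    unfolding monom_in_ideal_span using u by blast
  then have "(monom g * monom v :: ('x, 'k) mpoly) \<in> ideal_span (monom ` set (take j us))"
    by (simp add: monom_def mult_single)
  then have "(monom g :: ('x, 'k) mpoly) \<in> ideal_span (monom ` set (take j us))"
    using reg ij unfolding regular_sequence_def set_take[symmetric] by (simp add: uv)
  then obtain w where w: "w \<in> set us" "g \<in> multiples w"
    unfolding monom_in_ideal_span by (meson in_set_takeD)
  have "u \<in> multiples g"
    by (simp add: mem_multiples g_def lookup_minus)
  then have "u = w"
    using minimal_monomial_generators_antichain[OF I _ w(1)] multiples_trans[OF _ w(2)] ij uv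
    by simp
  \<comment> \<open>Now \<open>u\<close> divides \<open>g\<close>; with truncated subtraction this
    requires one of the two exponents to vanish at each \<open>x\<close>.\<close>
  then have "lookup u x \<le> lookup u x - lookup v x" for x
    using w by (simp add: mem_multiples g_def lookup_minus)
  then have "lookup u x = 0 \<or> lookup v x = 0" for x
    by (metis diff_less linorder_not_le neq0_conv)
  then show ?thesis by (simp add: coprime_expo_def uv)
qed

lemma monomial_complete_intersection_coprime_expo:
  fixes I :: "('x, 'k::field) mpoly set"
  assumes "monomial_complete_intersection I" and U: "minimal_monomial_generators I U"
    and uv: "u \<in> U" "v \<in> U" "u \<noteq> v"
  shows "coprime_expo u v"
proof -
  obtain us where us: "distinct us" "minimal_monomial_generators I (set us)"
      "regular_sequence (map monom us :: ('x, 'k) mpoly list)"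
    using assms unfolding monomial_complete_intersection_def by blast
  have "set us = U" by (rule minimal_monomial_generators_unique[OF us(2) U])
  then obtain i j where ij: "i < length us" "u = us ! i" "j < length us" "v = us ! j"
    using uv(1,2) by (metis in_set_conv_nth)
  have "i \<noteq> j" using ij \<open>u \<noteq> v\<close> by blast
  \<comment> \<open>Either generator may come first in the sequence; coprimality is
    symmetric.\<close>
  then have "i < j \<or> j < i" by linarith
  then show ?thesis
    using regular_sequence_coprime_expo[OF us] ij coprime_expo_commute by metis
qed

section \<open>Cone decompositions\<close>

text \<open>The exponents of the monomial \<open>K\<close>-basis of the Stanley space generated by
  \<open>monom a\<close> over \<open>K[Z]\<close>.\<close>

definition cone :: "'x expo \<Rightarrow> 'x set \<Rightarrow> 'x expo set"
  where "cone a Z = (+) a ` {s. keys s \<subseteq> Z}"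

lemma multiples_eq_cone: "multiples u = cone u UNIV"
  by (simp add: multiples_def cone_def)

text \<open>The number counts the disjoint cones and becomes the length of a Stanley
  decomposition.\<close>

inductive cone_decomp :: "nat \<Rightarrow> 'x expo set \<Rightarrow> bool"
  where
    empty: "cone_decomp 0 {}"
  | step: "cone_decomp n T \<Longrightarrow> cone a Z \<inter> T = {} \<Longrightarrow> cone_decomp (Suc n) (cone a Z \<union> T)"

lemma cone_decomp_cone: "cone_decomp 1 (cone a Z)"
  using cone_decomp.step[OF cone_decomp.empty, of a Z] by simp

lemma cone_decomp_Un:
  "cone_decomp m A \<Longrightarrow> cone_decomp n B \<Longrightarrow> A \<inter> B = {} \<Longrightarrow> cone_decomp (m + n) (A \<union> B)"
proof (induction rule: cone_decomp.induct)
  case (step m T a Z)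
  then have "cone_decomp (Suc (m + n)) (cone a Z \<union> (T \<union> B))"
    by (intro cone_decomp.step) auto
  then show ?case by (simp add: Un_assoc)
qed simp

lemma cone_translate: "(+) b ` cone a Z = cone (b + a) Z"
  by (simp add: cone_def image_image add.assoc)

lemma cone_decomp_translate: "cone_decomp n T \<Longrightarrow> cone_decomp n ((+) b ` T)"
proof (induction rule: cone_decomp.induct)
  case (step n T a Z)
  \<comment> \<open>Translation is injective, so it preserves disjointness.\<close>
  have "(+) b ` cone a Z \<inter> (+) b ` T = (+) b ` (cone a Z \<inter> T)"
    by (simp add: image_Int)
  then show ?case
    using step cone_decomp.step[of n "(+) b ` T" "b + a" Z]
    by (simp add: image_Un cone_translate)
qed (simp add: cone_decomp.empty)

lemma cone_coordinate: "cone (Poly_Mapping.single x k) (- {x}) = {t. lookup t x = k}"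
proof (intro set_eqI iffI)
  fix t assume "t \<in> cone (Poly_Mapping.single x k) (- {x})"
  then obtain s where "t = Poly_Mapping.single x k + s" "x \<notin> keys s" by (auto simp: cone_def)
  then show "t \<in> {t. lookup t x = k}" by (simp add: lookup_add in_keys_iff)
next
  fix t assume t: "t \<in> {t. lookup t x = k}"
  define s where "s = t - Poly_Mapping.single x k"
  have "t = Poly_Mapping.single x k + s"
    using t by (intro poly_mapping_eqI) (auto simp: s_def lookup_add lookup_minus lookup_single when_def)
  moreover have "x \<notin> keys s"
    using t by (simp add: s_def in_keys_iff lookup_minus)
  ultimately show "t \<in> cone (Poly_Mapping.single x k) (- {x})"
    by (auto simp: cone_def)
qed

text \<open>One cone for each value \<open>0, ..., k - 1\<close> of the exponent of
  \<open>x\<close>.\<close>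

lemma cone_decomp_coordinate_less: "cone_decomp k {t. lookup t x < k}"
proof (induction k)
  case 0
  then show ?case by (simp add: cone_decomp.empty)
next
  case (Suc k)
  have "{t. lookup t x < Suc k} = cone (Poly_Mapping.single x k) (- {x}) \<union> {t. lookup t x < k}"
    by (auto simp: cone_coordinate)
  then show ?case
    using cone_decomp.step[OF Suc, of "Poly_Mapping.single x k" "- {x}"]
    by (simp add: cone_coordinate disjoint_iff)
qed

text \<open>Adding \<open>x\<close> to \<open>A\<close> contributes \<open>lookup u x\<close> slices
  where the bound already fails at \<open>x\<close>. The rest is a translate of the set for
  \<open>A\<close> and costs no extra cones.\<close>

lemma cone_decomp_some_coordinate_less:
  "finite A \<Longrightarrow> cone_decomp (\<Sum>x\<in>A. lookup u x) {t. \<exists>x\<in>A. lookup t x < lookup u x}"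
proof (induction A rule: finite_induct)
  case empty
  then show ?case by (simp add: cone_decomp.empty)
next
  case (insert x A)
  let ?a = "Poly_Mapping.single x (lookup u x)"
  let ?T = "{t. \<exists>x\<in>A. lookup t x < lookup u x}"
  \<comment> \<open>\<open>?a\<close> only raises the exponent of \<open>x\<close>, and
    \<open>x\<close> is not in \<open>A\<close>, so the conditions on \<open>A\<close> are
    unaffected.\<close>
  have translate: "(+) ?a ` ?T = {t. lookup u x \<le> lookup t x} \<inter> ?T" (is "_ = ?R")
  proof (intro set_eqI iffI)
    fix t assume "t \<in> (+) ?a ` ?T"
    then obtain s y where s: "t = ?a + s" "y \<in> A" "lookup s y < lookup u y" by blast
    moreover from this insert have "x \<noteq> y" by blast
    ultimately show "t \<in> ?R" by (auto simp: lookup_add lookup_single intro!: bexI[of _ y])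
  next
    fix t assume "t \<in> ?R"
    then obtain y where y: "lookup u x \<le> lookup t x" "y \<in> A" "lookup t y < lookup u y" by blast
    have "t = ?a + (t - ?a)"
      using y by (intro poly_mapping_eqI) (auto simp: lookup_add lookup_minus lookup_single when_def)
    moreover have "t - ?a \<in> ?T"
      using y by (auto simp: lookup_minus intro!: bexI[of _ y])
    ultimately show "t \<in> (+) ?a ` ?T" by blast
  qed
  have "cone_decomp (lookup u x + (\<Sum>x\<in>A. lookup u x))
      ({t. lookup t x < lookup u x} \<union> (+) ?a ` ?T)"
    unfolding translate[symmetric]
    by (intro cone_decomp_Un cone_decomp_coordinate_less cone_decomp_translate insert.IH)
      (auto simp: translate)
  moreover have "{t. lookup t x < lookup u x} \<union> (+) ?a ` ?T =
      {t. \<exists>x\<in>insert x A. lookup t x < lookup u x}"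
    unfolding translate by auto
  ultimately show ?case using insert by simp
qed

section \<open>Cones among multiples and non-multiples of monomials\<close>

lemma cone_decomp_Compl_multiples: "cone_decomp (mdeg u) (- multiples u)"
proof -
  have "- multiples u = {t. \<exists>x\<in>UNIV. lookup t x < lookup u x}"
    by (auto simp: mem_multiples simp flip: not_le)
  then show ?thesis
    using cone_decomp_some_coordinate_less[of UNIV u] by (simp add: mdeg_def)
qed

lemma cone_decomp_multiples_Diff:
  assumes "coprime_expo u v"
  shows "cone_decomp (mdeg v) (multiples u - multiples v)"
proof -
  have "u + s \<in> multiples v \<longleftrightarrow> s \<in> multiples v" for s
  proof -
    \<comment> \<open>If \<open>u\<close> vanishes at \<open>x\<close>, both sides agree; if
      \<open>v\<close> does, both are trivially true.\<close>
    have "lookup v x \<le> lookup (u + s) x \<longleftrightarrow> lookup v x \<le> lookup s x" for x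
      using assms[unfolded coprime_expo_def, rule_format, of x] by (auto simp: lookup_add)
    then show ?thesis by (simp add: mem_multiples)
  qed
  then have "multiples u - multiples v = (+) u ` (- multiples v)"
    by (auto simp: multiples_def[of u])
  then show ?thesis
    by (simp add: cone_decomp_translate cone_decomp_Compl_multiples)
qed

text \<open>The least common multiple of coprime monomials is their product.\<close>

lemma multiples_Int_multiples:
  assumes "coprime_expo u v"
  shows "multiples u \<inter> multiples v = multiples (u + v)"
proof -
  have "lookup u x \<le> k \<and> lookup v x \<le> k \<longleftrightarrow> lookup (u + v) x \<le> k" for x k
    using assms[unfolded coprime_expo_def, rule_format, of x] by (auto simp: lookup_add)
  then show ?thesis by (simp add: set_eq_iff mem_multiples) blast
qed

lemma cone_decomp_three_multiples:
  assumes 12: "coprime_expo u1 u2" and 13: "coprime_expo u1 u3" and 23: "coprime_expo u2 u3"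
  shows "cone_decomp (mdeg u1 + mdeg u2 + mdeg u3 + 1) (multiples u1 \<union> multiples u2 \<union> multiples u3)"
proof -
  have "coprime_expo (u1 + u2) u3"
    using 13 23 by (auto simp: coprime_expo_def lookup_add)
  then have all: "multiples u1 \<inter> multiples u2 \<inter> multiples u3 = cone (u1 + u2 + u3) UNIV"
    using 12 by (simp add: multiples_Int_multiples flip: multiples_eq_cone)
  \<comment> \<open>Each difference costs the degree of the monomial removed, in the order of the
    sum. In the cycle 1, 3, 2 a nonempty proper subset has exactly one member whose successor is
    missing, so the differences are disjoint and omit only the common multiples.\<close>
  have "cone_decomp (mdeg u1 + mdeg u2 + mdeg u3 + 1)
     ((((multiples u2 - multiples u1) \<union> (multiples u3 - multiples u2)) \<union>
       (multiples u1 - multiples u3)) \<union> multiples u1 \<inter> multiples u2 \<inter> multiples u3)"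
    by (intro cone_decomp_Un cone_decomp_multiples_Diff
        cone_decomp_cone[of "u1 + u2 + u3" UNIV, folded all])
      (use assms coprime_expo_commute in blast)+
  moreover have "((multiples u2 - multiples u1) \<union> (multiples u3 - multiples u2)) \<union>
      (multiples u1 - multiples u3) \<union> multiples u1 \<inter> multiples u2 \<inter> multiples u3 =
      multiples u1 \<union> multiples u2 \<union> multiples u3"
    by blast
  ultimately show ?thesis by simp
qed

text \<open>Passes to the indexed form in which direct sums are stated.\<close>

lemma cone_decomp_family:
  "cone_decomp n T \<Longrightarrow> \<exists>a Z. T = (\<Union>i<n. cone (a i) (Z i)) \<and>
     disjoint_family_on (\<lambda>i. cone (a i) (Z i)) {..<n}"
proof (induction rule: cone_decomp.induct)
  case empty
  then show ?case by (simp add: disjoint_family_on_def)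
next
  case (step n T b Y)
  then obtain a Z where T: "T = (\<Union>i<n. cone (a i) (Z i))"
    and disj: "disjoint_family_on (\<lambda>i. cone (a i) (Z i)) {..<n}" by blast
  \<comment> \<open>The new cone takes index \<open>n\<close>, leaving the earlier ones in
    place.\<close>
  let ?C = "\<lambda>i. cone ((a(n := b)) i) ((Z(n := Y)) i)"
  have eq: "?C i = cone (a i) (Z i)" if "i < n" for i using that by simp
  have "cone b Y \<union> T = (\<Union>i<Suc n. ?C i)"
    unfolding T lessThan_Suc by auto
  moreover have "disjoint_family_on ?C {..<Suc n}"
  proof -
    have "disjoint_family_on ?C {..<n}"
      using disj unfolding disjoint_family_on_def by simp
    moreover have "?C n \<inter> (\<Union>i<n. ?C i) = {}"
      using step T by simp
    ultimately show ?thesis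
      by (simp only: lessThan_Suc disjoint_family_on_insert lessThan_iff order.irrefl not_False_eq_True)
  qed
  ultimately show ?case by blast
qed

section \<open>Stanley decompositions from cone decompositions\<close>

lemma stanley_space_monom:
  "stanley_space (*) (monom a) Z = {f :: ('x, 'k::field) mpoly. keys f \<subseteq> cone a Z}"
proof (intro set_eqI iffI)
  fix f :: "('x, 'k) mpoly"
  assume "f \<in> stanley_space (*) (monom a) Z"
  then obtain g where g: "f = g * monom a" "\<forall>t\<in>keys g. keys t \<subseteq> Z"
    by (auto simp: stanley_space_def poly_subring_def)
  then show "f \<in> {f. keys f \<subseteq> cone a Z}"
    using keys_times_monom[of g a] by (fastforce simp: cone_def add.commute)
next
  fix f :: "('x, 'k) mpoly"
  assume f: "f \<in> {f. keys f \<subseteq> cone a Z}"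
  \<comment> \<open>Termwise division by \<open>monom a\<close>; the truncated subtraction is exact
    on the cone.\<close>
  define g where "g = (\<Sum>t\<in>keys f. Poly_Mapping.single (t - a) (lookup f t))"
  have "keys g \<subseteq> (\<lambda>t. t - a) ` keys f"
    unfolding g_def using keys_sum[of "\<lambda>t. Poly_Mapping.single (t - a) (lookup f t)" "keys f"]
    by (auto split: if_splits)
  moreover have "keys (t - a) \<subseteq> Z" if t: "t \<in> keys f" for t
  proof -
    obtain s where "t = a + s" "keys s \<subseteq> Z"
      using t f unfolding cone_def by blast
    then show ?thesis by simp
  qed
  ultimately have "g \<in> poly_subring Z"
    unfolding poly_subring_def by blast
  moreover have "g * monom a = f"
  proof -
    have "g * monom a = (\<Sum>t\<in>keys f. Poly_Mapping.single (t - a + a) (lookup f t))"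
      by (simp add: g_def sum_distrib_right monom_def mult_single)
    also have "\<dots> = (\<Sum>t\<in>keys f. Poly_Mapping.single t (lookup f t))"
    proof (rule sum.cong)
      fix t assume "t \<in> keys f"
      then have "t - a + a = t" using f by (auto simp: cone_def add.commute)
      then show "Poly_Mapping.single (t - a + a) (lookup f t) = Poly_Mapping.single t (lookup f t)"
        by simp
    qed simp
    finally show ?thesis by (simp add: sum_single_lookup)
  qed
  ultimately show "f \<in> stanley_space (*) (monom a) Z"
    by (auto simp: stanley_space_def)
qed

text \<open>Needed because the entries \<open>D ! i\<close> are known only for indices below the
  length.\<close>

lemma direct_sum_decomp_cong:
  assumes "\<And>i. i < n \<Longrightarrow> V i = W i"
  shows "direct_sum_decomp M n V = direct_sum_decomp M n W"
proof -
  have "(\<forall>i<n. v i \<in> V i) = (\<forall>i<n. v i \<in> W i)" for v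
    using assms by simp
  then show ?thesis by (simp add: direct_sum_decomp_def)
qed

text \<open>Each term is sorted into the block containing its exponent; disjointness makes the
  sorting unique.\<close>

lemma direct_sum_decomp_keys:
  fixes C :: "nat \<Rightarrow> 'a set"
  assumes disj: "disjoint_family_on C {..<n}"
  shows "direct_sum_decomp {f :: 'a \<Rightarrow>\<^sub>0 'k::ab_group_add. keys f \<subseteq> (\<Union>i<n. C i)} n
    (\<lambda>i. {f. keys f \<subseteq> C i})"
  unfolding direct_sum_decomp_def
proof (intro conjI allI impI set_eqI iffI)
  fix f :: "'a \<Rightarrow>\<^sub>0 'k"
  assume f: "f \<in> {f. keys f \<subseteq> (\<Union>i<n. C i)}"
  define v where "v i = (\<Sum>t\<in>keys f \<inter> C i. Poly_Mapping.single t (lookup f t))"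
    for i
  have "(\<Sum>i<n. v i) = (\<Sum>t\<in>(\<Union>i<n. keys f \<inter> C i). Poly_Mapping.single t (lookup f t))"
    unfolding v_def using disj by (intro sum.UNION_disjoint[symmetric]) (auto simp: disjoint_family_on_def)
  also have "(\<Union>i<n. keys f \<inter> C i) = keys f" using f by blast
  finally have "f = (\<Sum>i<n. v i)" by (simp add: sum_single_lookup)
  moreover have "keys (v i) \<subseteq> C i" for i
    unfolding v_def using keys_sum[of "\<lambda>t. Poly_Mapping.single t (lookup f t)" "keys f \<inter> C i"]
    by (auto split: if_splits)
  ultimately show "f \<in> {\<Sum>i<n. v i |v. \<forall>i<n. v i \<in> {f. keys f \<subseteq> C i}}"
    by (intro CollectI exI[of _ v]) simp
next
  fix f :: "'a \<Rightarrow>\<^sub>0 'k"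
  assume "f \<in> {\<Sum>i<n. v i | v. \<forall>i<n. v i \<in> {f. keys f \<subseteq> C i}}"
  then obtain v where "f = (\<Sum>i<n. v i)" "\<And>i. i < n \<Longrightarrow> keys (v i) \<subseteq> C i"
    by auto
  then show "f \<in> {f. keys f \<subseteq> (\<Union>i<n. C i)}"
    using keys_sum[of v "{..<n}"] by fastforce
next
  fix v :: "nat \<Rightarrow> 'a \<Rightarrow>\<^sub>0 'k" and i
  assume v: "(\<forall>i<n. v i \<in> {f. keys f \<subseteq> C i}) \<and> (\<Sum>i<n. v i) = 0" and i: "i < n"
  show "v i = 0"
  proof (rule ccontr)
    assume "v i \<noteq> 0"
    then obtain t where t: "t \<in> keys (v i)" by (metis in_keys_iff lookup_zero poly_mapping_eqI)
    \<comment> \<open>Only \<open>v i\<close> can contribute at \<open>t\<close>, so nothing cancels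
      its coefficient in the sum.\<close>
    have "lookup (v j) t = 0" if "j < n" "j \<noteq> i" for j
    proof -
      have "t \<in> C i" using t v i by blast
      then have "t \<notin> C j" using disj that i by (auto simp: disjoint_family_on_def)
      then have "t \<notin> keys (v j)" using v that by blast
      then show ?thesis by (simp add: in_keys_iff)
    qed
    then have "(\<Sum>j<n. lookup (v j) t) = lookup (v i) t"
      using i by (subst sum.mono_neutral_right[of _ "{i}"]) auto
    then have "lookup (v i) t = 0" using v by (simp flip: lookup_sum)
    then show False using t by (simp add: in_keys_iff)
  qed
qed

lemma cone_decomp_slength_le:
  assumes "cone_decomp n T"
  shows "ideal_slength {f :: ('x::finite, 'k::field) mpoly. keys f \<subseteq> T} \<le> enat n"
proof -
  obtain a Z where T: "T = (\<Union>i<n. cone (a i) (Z i))"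
    and disj: "disjoint_family_on (\<lambda>i. cone (a i) (Z i)) {..<n}"
    using cone_decomp_family[OF assms] by blast
  define D where "D = map (\<lambda>i. (monom (a i) :: ('x, 'k) mpoly, Z i)) [0..<n]"
  have length_D: "length D = n" by (simp add: D_def)
  \<comment> \<open>The exponent \<open>a i\<close> lies in its own cone, with translation vector
    \<open>0\<close>.\<close>
  have generator: "monom (a i) \<in> {f :: ('x, 'k) mpoly. keys f \<subseteq> T}" if "i < n" for i
    using that unfolding T by (auto simp: monom_def cone_def intro!: bexI[of _ i] image_eqI[of _ _ 0])
  have homogeneous: "\<exists>b. monom t \<in> (mpoly_component b :: ('x, 'k) mpoly set)" for t
    by (simp add: mpoly_component_def monom_def)
  have free: "f = 0" if "f * monom t = 0" for f :: "('x, 'k) mpoly" and t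
    using that lookup_times_monom[of f t] by (intro poly_mapping_eqI) (metis lookup_zero)
  have "direct_sum_decomp {f :: ('x, 'k) mpoly. keys f \<subseteq> T} (length D)
      (\<lambda>i. stanley_space (*) (fst (D ! i)) (snd (D ! i)))"
  proof -
    have eq: "stanley_space (*) (fst (D ! i)) (snd (D ! i)) =
        {f. keys f \<subseteq> cone (a i) (Z i)}"
      if "i < n" for i using that by (simp add: D_def stanley_space_monom)
    show ?thesis
      using direct_sum_decomp_keys[OF disj]
      unfolding T length_D by (simp add: eq cong: direct_sum_decomp_cong)
  qed
  then have "stanley_decomposition (*) mpoly_component {f :: ('x, 'k) mpoly. keys f \<subseteq> T} D"
    unfolding stanley_decomposition_def
    using generator homogeneous free by (auto simp: D_def)
  \<comment> \<open>The Stanley length is an infimum, so exhibiting \<open>D\<close> bounds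
    it.\<close>
  then show ?thesis
    unfolding length_D[symmetric] ideal_slength_def slength_def by (intro INF_lower) simp
qed

theorem proposition2p22:
  fixes I :: "('x::finite, 'k::field) mpoly set"
    and u1 u2 u3 :: "'x expo"
    and d1 d2 d3 :: nat
  assumes "monomial_complete_intersection I"
    and "distinct [u1, u2, u3]"
    and "minimal_monomial_generators I {u1, u2, u3}"
    and "mdeg u1 = d1" and "mdeg u2 = d2" and "mdeg u3 = d3"
  shows "ideal_slength I \<le> enat (d1 + d2 + d3 + 1)"
proof -
  have "coprime_expo u1 u2" "coprime_expo u1 u3" "coprime_expo u2 u3"
    using assms(2) by (auto intro!: monomial_complete_intersection_coprime_expo[OF assms(1,3)])
  then have "cone_decomp (d1 + d2 + d3 + 1) (multiples u1 \<union> multiples u2 \<union> multiples u3)"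
    using cone_decomp_three_multiples assms(4-6) by blast
  \<comment> \<open>The ideal consists of the polynomials supported on the union just
    decomposed.\<close>
  moreover have "I = {f. keys f \<subseteq> multiples u1 \<union> multiples u2 \<union> multiples u3}"
    using assms(3) unfolding minimal_monomial_generators_def ideal_span_monom by (simp add: Un_assoc)
  ultimately show ?thesis using cone_decomp_slength_le by metis
qed

end
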